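(* Let $n\geq3$ be an integer and let $C_n$ be the cycle on $n$ vertices. Then $s(C_n)=3$.
   Context: A vertex labeling of a graph $G$ is an injective map $f:V(G)\to\mathbb{Z}$. It induces the edge labeling $f^+:E(G)\to\mathbb{Z}$, $f^+(uv)=f(u)+f(v)$, and $|f^+|$ denotes the number of distinct values $f^+$ takes on $E(G)$. The sum index $s(G)$ is the minimum positive integer $k$ such that there exists a vertex labeling $f$ of $G$ with $|f^+|=k$. *)

theory Defs
  imports Main
begin

text \<open>Undirected graphs; an edge is the two-element set of its endpoints.\<close>

record 'a graph =
  verts :: "'a set"
  edges :: "'a set set"

definition simple_graph :: "'a graph \<Rightarrow> bool" where
  "simple_graph G \<longleftrightarrow>
     finite (verts G) \<and> (\<forall>e \<in> edges G. e \<subseteq> verts G \<and> card e = 2)"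

text \<open>Labels outside \<open>verts G\<close> are irrelevant, so a labeling is a total function that is
  injective on \<open>verts G\<close>. Labels may be arbitrary (also negative) integers.\<close>

definition vertex_labeling :: "'a graph \<Rightarrow> ('a \<Rightarrow> int) \<Rightarrow> bool" where
  "vertex_labeling G f \<longleftrightarrow> inj_on f (verts G)"

definition edge_label :: "('a \<Rightarrow> int) \<Rightarrow> 'a set \<Rightarrow> int" where
  "edge_label f e = (\<Sum>v\<in>e. f v)"

lemma edge_label_pair: "u \<noteq> v \<Longrightarrow> edge_label f {u, v} = f u + f v"
  by (simp add: edge_label_def)

definition sum_index :: "'a graph \<Rightarrow> nat" where
  "sum_index G =
     (LEAST k. 0 < k \<and> (\<exists>f. vertex_labeling G f \<and> card (edge_label f ` edges G) = k))"

text \<open>For \<open>n < 3\<close> the following is not a simple cycle (loops or a single edge arise).\<close>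

definition cycle_graph :: "nat \<Rightarrow> nat graph" where
  "cycle_graph n =
     \<lparr> verts = {0..<n}, edges = {{i, (i + 1) mod n} | i. i < n} \<rparr>"

lemma simple_graph_cycle_graph:
  assumes "3 \<le> n"
  shows "simple_graph (cycle_graph n)"
proof -
  have "i \<noteq> (i + 1) mod n \<and> (i + 1) mod n < n" if "i < n" for i
    using that assms by (cases "i + 1 = n") auto
  then show ?thesis
    by (auto simp: simple_graph_def cycle_graph_def card_insert_if)
qed

end

theory Submission
  imports Defs
begin

text \<open>
  Two edges sharing a vertex never have the same label, because the labeling is injective on
  their other endpoints. If only two edge labels \<open>a\<close> and \<open>b\<close> occurred, they would
  therefore alternate while walking around the cycle. The vertex label would then change by
  the same amount \<open>b - a \<noteq> 0\<close> every two steps, so that after walking around the cycle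
  twice, \<open>2 * n\<close> steps, it would have changed by \<open>n * (b - a) \<noteq> 0\<close>,
  although the walk is back at its start. Walking around twice makes the argument
  independent of the parity of \<open>n\<close>. This is \<open>cycle_edge_labels_ge_3\<close>.

  Conversely, the labels \<open>0, -1, 1, -2, 2, \<dots>\<close> in cyclic order give the edge labels
  \<open>-1\<close> and \<open>0\<close> alternately along the path from \<open>0\<close> to \<open>n - 1\<close>, and the one
  remaining edge adds at most one more value (\<open>zigzag_edge_labels_le_3\<close>).
\<close>

lemma edge_labels_cycle_graph:
  assumes "3 \<le> n"
  shows "edge_label f ` edges (cycle_graph n) = (\<lambda>i. f i + f (Suc i mod n)) ` {..<n}"
proof -
  have "edge_label f {i, Suc i mod n} = f i + f (Suc i mod n)" if "i < n" for i
    using that assms by (intro edge_label_pair) (cases "Suc i = n", auto)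
  moreover have "edges (cycle_graph n) = (\<lambda>i. {i, Suc i mod n}) ` {..<n}"
    by (auto simp: cycle_graph_def)
  ultimately show ?thesis
    by (simp add: image_image)
qed

lemma cycle_edge_labels_ge_3:
  assumes n: "3 \<le> n" and f: "vertex_labeling (cycle_graph n) f"
  shows "3 \<le> card (edge_label f ` edges (cycle_graph n))"
proof (rule ccontr)
  let ?S = "edge_label f ` edges (cycle_graph n)"
  assume few: "\<not> 3 \<le> card ?S"
  \<comment> \<open>The labels are extended periodically to all naturals, so as to walk around repeatedly.\<close>
  define g where "g i = f (i mod n)" for i
  define s where "s i = g i + g (Suc i)" for i
  have s_in: "s i \<in> ?S" for i
  proof -
    have "s i = f (i mod n) + f (Suc (i mod n) mod n)"
      by (simp add: s_def g_def mod_Suc_eq)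
    then show ?thesis
      using n by (auto simp: edge_labels_cycle_graph)
  qed
  have consecutive: "s i \<noteq> s (Suc i)" for i
  proof
    assume "s i = s (Suc i)"
    then have "f (i mod n) = f ((i + 2) mod n)"
      by (simp add: s_def g_def)
    moreover have "inj_on f {0..<n}"
      using f by (simp add: vertex_labeling_def cycle_graph_def)
    ultimately have "i mod n = (i + 2) mod n"
      using n by (auto dest: inj_onD)
    then have "n dvd (i + 2) - i"
      using mod_eq_dvd_iff_nat[of i "i + 2" n] by simp
    then show False
      using n by (auto dest: dvd_imp_le)
  qed
  have finite: "finite ?S"
    using n by (simp add: edge_labels_cycle_graph)
  have alternate: "s (i + 2) = s i" for i
  proof (rule ccontr)
    assume "s (i + 2) \<noteq> s i"
    then have "card {s i, s (Suc i), s (i + 2)} = 3"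
      using consecutive[of i] consecutive[of "Suc i"] by auto
    moreover have "{s i, s (Suc i), s (i + 2)} \<subseteq> ?S"
      using s_in by blast
    ultimately show False
      using few card_mono[OF finite] by metis
  qed
  have s_even: "s (2 * k) = s 0" and s_odd: "s (Suc (2 * k)) = s 1" for k
    using alternate by (induction k) (simp_all add: add.commute)
  have g_even: "g (2 * k) = g 0 + int k * (s 1 - s 0)" for k
  proof (induction k)
    case (Suc k)
    have "g (2 * Suc k) = g (2 * k) + (s (Suc (2 * k)) - s (2 * k))"
      by (simp add: s_def)
    also have "\<dots> = g (2 * k) + (s 1 - s 0)"
      by (simp only: s_even s_odd)
    finally show ?case
      using Suc by (simp add: algebra_simps)
  qed simp
  have "g (2 * n) = g 0"
    by (simp add: g_def)
  then have "s 1 = s 0"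
    using g_even[of n] n by simp
  then show False
    using consecutive[of 0] by simp
qed

definition zigzag :: "nat \<Rightarrow> int" where
  "zigzag i = (if even i then int (i div 2) else - int (i div 2) - 1)"

lemma inj_zigzag: "inj zigzag"
proof (rule injI)
  fix i j assume "zigzag i = zigzag j"
  then show "i = j"
    by (auto simp: zigzag_def elim!: evenE oddE split: if_splits)
qed

lemma zigzag_add_Suc: "zigzag i + zigzag (Suc i) = (if even i then -1 else 0)"
  by (auto simp: zigzag_def elim!: evenE oddE)

lemma zigzag_edge_labels_le_3:
  assumes n: "3 \<le> n"
  shows "card (edge_label zigzag ` edges (cycle_graph n)) \<le> 3"
proof -
  have "zigzag i + zigzag (Suc i mod n) \<in> {-1, 0, zigzag (n - 1) + zigzag 0}" if "i < n" for i
  proof (cases "Suc i = n")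
    case True
    then show ?thesis by auto
  next
    case False
    then show ?thesis
      using that by (simp add: zigzag_add_Suc)
  qed
  then have "edge_label zigzag ` edges (cycle_graph n) \<subseteq> {-1, 0, zigzag (n - 1) + zigzag 0}"
    using n by (auto simp: edge_labels_cycle_graph)
  then have "card (edge_label zigzag ` edges (cycle_graph n))
      \<le> card {-1, 0, zigzag (n - 1) + zigzag 0}"
    by (intro card_mono) auto
  also have "\<dots> \<le> 3"
    by (simp add: card_insert_if)
  finally show ?thesis .
qed

theorem theorem2p9:
  fixes n :: nat
  assumes "n \<ge> 3"
  shows "sum_index (cycle_graph n) = 3"
  unfolding sum_index_def
proof (rule Least_equality)
  have "vertex_labeling (cycle_graph n) zigzag"
    using inj_zigzag by (auto simp: vertex_labeling_def intro: inj_on_subset)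
  moreover from this have "card (edge_label zigzag ` edges (cycle_graph n)) = 3"
    using cycle_edge_labels_ge_3 zigzag_edge_labels_le_3 assms by (intro antisym)
  ultimately show "0 < (3::nat) \<and> (\<exists>f. vertex_labeling (cycle_graph n) f \<and>
      card (edge_label f ` edges (cycle_graph n)) = 3)"
    by auto
next
  fix k :: nat
  assume "0 < k \<and> (\<exists>f. vertex_labeling (cycle_graph n) f \<and>
      card (edge_label f ` edges (cycle_graph n)) = k)"
  then show "3 \<le> k"
    using cycle_edge_labels_ge_3 assms by blast
qed

end
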